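(* Suppose the following statement (P) holds: for every finite simple graph $G$, every edge colouring $c:E(G)\to\{1,\dots,k\}$ and every $f:V(G)\to\mathbb{N}$ with $f(v)\le d^c(v)$ for all $v$, $G^c$ has a properly coloured $f$-factor if and only if $\mathrm{odd}(G^c_f-X_{\mathcal{S}})\le|X_{\mathcal{S}}|$ for every palette system $\mathcal{S}$ of $G^c$. Then Tutte's $f$-factor theorem follows: for every finite simple graph $G$ and every $f:V(G)\to\mathbb{N}$ with $f(v)\le d_G(v)$ for all $v$, $G$ has an $f$-factor if and only if $\mathrm{odd}(G_f-X_{S,T})\le|X_{S,T}|$ for every pair of disjoint subsets $S,T\subseteq V(G)$.
   Context: $\mathbb{N}$ includes $0$; $\mathrm{odd}(H)$ is the number of components of $H$ with an odd number of vertices. An $f$-factor is a spanning subgraph $F$ with $d_F(v)=f(v)$ for all $v$; it is properly coloured if adjacent edges of $F$ have distinct colours. The graph $G_f$: replace each vertex $u$ by a complete bipartite graph on $S_u=\{u_v: uv\in E(G)\}$ and $T_u=\{u'_i:1\le i\le d_G(u)-f(u)\}$, and add the edge $u_vv_u$ for each $uv\in E(G)$; $X_{S,T}=(\bigcup_{u\in S}S_u)\cup(\bigcup_{u\in T}T_u)$. For an edge colouring $c$: $E^c(u)$ is the set of colours at $u$, $d^c(u)=|E^c(u)|$. The graph $G^c_f$: replace each vertex $u$ by a complete bipartite graph with parts $S_u=\{u_i:i\in E^c(u)\}$, $T_u=\{u'_i:1\le i\le d^c(u)-f(u)\}$, and add $u_jv_j$ for each edge $uv$ with $c(uv)=j$.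 With $\hat f=\max f$, $\mathcal{C}_0=\bigcup_{0\le i\le\hat f-2}\binom{\{1,\dots,k\}}{i}$, $\mathcal{C}_1=\bigcup_{1\le i\le\hat f-1}\binom{\{1,\dots,k\}}{i}$, a palette system is a triple $(S,T,W)$ of pairwise disjoint vertex sets with $T$ a disjoint union of $T^A$ ($A\in\mathcal{C}_0$) and $W$ a disjoint union of $W^A$ ($A\in\mathcal{C}_1$); $X_{\mathcal{S}}=\bigcup_{u\in S}S_u\cup\bigcup_{A\in\mathcal{C}_0}\bigcup_{u\in T^A}(T_u\cup\{u_i:i\in A\})\cup\bigcup_{A\in\mathcal{C}_1}\bigcup_{u\in W^A}\{u_i:i\in A\}$ (with $u_i$ present only for $i\in E^c(u)$). *)

theory Defs
  imports Main "HOL-Library.FuncSet" "HOL-Library.Disjoint_Sets"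
begin

section \<open>Finite simple graphs\<close>

text \<open>A graph is a pair of a vertex set and a set of two-element edges.\<close>

type_synonym 'v graph = "'v set \<times> 'v set set"

abbreviation verts :: "'v graph \<Rightarrow> 'v set" where "verts \<equiv> fst"
abbreviation edges :: "'v graph \<Rightarrow> 'v set set" where "edges \<equiv> snd"

definition finite_simple_graph :: "'v graph \<Rightarrow> bool" where
  "finite_simple_graph G \<longleftrightarrow>
     finite (verts G) \<and> (\<forall>e\<in>edges G. e \<subseteq> verts G \<and> card e = 2)"

definition degree :: "'v graph \<Rightarrow> 'v \<Rightarrow> nat" where
  "degree G v = card {e \<in> edges G. v \<in> e}"

definition delete_verts :: "'v graph \<Rightarrow> 'v set \<Rightarrow> 'v graph" where
  "delete_verts G X = (verts G - X, {e \<in> edges G. e \<inter> X = {}})"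

definition adj :: "'v graph \<Rightarrow> ('v \<times> 'v) set" where
  "adj G = {(x, y). x \<in> verts G \<and> y \<in> verts G \<and> {x, y} \<in> edges G}"

definition components :: "'v graph \<Rightarrow> 'v set set" where
  "components G = {{y. (x, y) \<in> (adj G)\<^sup>*} | x. x \<in> verts G}"

definition odd_components :: "'v graph \<Rightarrow> nat" where
  "odd_components G = card {C \<in> components G. odd (card C)}"

definition spanning_subgraph :: "'v graph \<Rightarrow> 'v graph \<Rightarrow> bool" where
  "spanning_subgraph F G \<longleftrightarrow> verts F = verts G \<and> edges F \<subseteq> edges G"

definition f_factor :: "'v graph \<Rightarrow> ('v \<Rightarrow> nat) \<Rightarrow> 'v graph \<Rightarrow> bool" where
  "f_factor G f F \<longleftrightarrow> spanning_subgraph F G \<and> (\<forall>v\<in>verts G. degree F v = f v)"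

section \<open>The graph $G_f$\<close>

text \<open>
  \<open>Port u x\<close> is the vertex $u_x$ and \<open>Slack u i\<close> the vertex $u'_i$. The label \<open>x\<close> is a neighbour
  of \<open>u\<close> in $G_f$ and a colour at \<open>u\<close> in $G^c_f$.
\<close>

datatype ('v, 'l) gadget_vertex = Port 'v 'l | Slack 'v nat

definition S_part :: "'v graph \<Rightarrow> 'v \<Rightarrow> ('v, 'v) gadget_vertex set" where
  "S_part G u = {Port u v | v. {u, v} \<in> edges G}"

definition T_part :: "'v graph \<Rightarrow> ('v \<Rightarrow> nat) \<Rightarrow> 'v \<Rightarrow> ('v, 'v) gadget_vertex set" where
  "T_part G f u = {Slack u i | i. 1 \<le> i \<and> i \<le> degree G u - f u}"

definition gadget_graph :: "'v graph \<Rightarrow> ('v \<Rightarrow> nat) \<Rightarrow> ('v, 'v) gadget_vertex graph" where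
  "gadget_graph G f =
     (\<Union>u\<in>verts G. S_part G u \<union> T_part G f u,
      {{s, t} | s t u. u \<in> verts G \<and> s \<in> S_part G u \<and> t \<in> T_part G f u} \<union>
      {{Port u v, Port v u} | u v. {u, v} \<in> edges G})"

definition X_ST ::
  "'v graph \<Rightarrow> ('v \<Rightarrow> nat) \<Rightarrow> 'v set \<Rightarrow> 'v set \<Rightarrow> ('v, 'v) gadget_vertex set" where
  "X_ST G f S T = (\<Union>u\<in>S. S_part G u) \<union> (\<Union>u\<in>T. T_part G f u)"

section \<open>Edge-coloured graphs and the graph $G^c_f$\<close>

definition edge_colouring :: "'v graph \<Rightarrow> nat \<Rightarrow> ('v set \<Rightarrow> nat) \<Rightarrow> bool" where
  "edge_colouring G k c \<longleftrightarrow> c \<in> edges G \<rightarrow> {1..k}"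

definition colours_at :: "'v graph \<Rightarrow> ('v set \<Rightarrow> nat) \<Rightarrow> 'v \<Rightarrow> nat set" where
  "colours_at G c u = c ` {e \<in> edges G. u \<in> e}"

definition colour_degree :: "'v graph \<Rightarrow> ('v set \<Rightarrow> nat) \<Rightarrow> 'v \<Rightarrow> nat" where
  "colour_degree G c u = card (colours_at G c u)"

definition properly_coloured :: "'v graph \<Rightarrow> ('v set \<Rightarrow> nat) \<Rightarrow> bool" where
  "properly_coloured F c \<longleftrightarrow>
     (\<forall>e\<in>edges F. \<forall>e'\<in>edges F. e \<noteq> e' \<and> e \<inter> e' \<noteq> {} \<longrightarrow> c e \<noteq> c e')"

definition S_part_col ::
  "'v graph \<Rightarrow> ('v set \<Rightarrow> nat) \<Rightarrow> 'v \<Rightarrow> ('v, nat) gadget_vertex set" where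
  "S_part_col G c u = {Port u i | i. i \<in> colours_at G c u}"

definition T_part_col ::
  "'v graph \<Rightarrow> ('v set \<Rightarrow> nat) \<Rightarrow> ('v \<Rightarrow> nat) \<Rightarrow> 'v \<Rightarrow> ('v, nat) gadget_vertex set" where
  "T_part_col G c f u = {Slack u i | i. 1 \<le> i \<and> i \<le> colour_degree G c u - f u}"

definition gadget_graph_col ::
  "'v graph \<Rightarrow> ('v set \<Rightarrow> nat) \<Rightarrow> ('v \<Rightarrow> nat) \<Rightarrow> ('v, nat) gadget_vertex graph" where
  "gadget_graph_col G c f =
     (\<Union>u\<in>verts G. S_part_col G c u \<union> T_part_col G c f u,
      {{s, t} | s t u. u \<in> verts G \<and> s \<in> S_part_col G c u \<and> t \<in> T_part_col G c f u} \<union>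
      {{Port u j, Port v j} | u v j. {u, v} \<in> edges G \<and> c {u, v} = j})"

section \<open>Palette systems\<close>

text \<open>
  \<open>Max {}\<close> is unspecified, so \<open>f_max\<close> carries no information for the graph without vertices; there
  every palette system consists of empty sets, whatever that value is.
\<close>

definition f_max :: "'v graph \<Rightarrow> ('v \<Rightarrow> nat) \<Rightarrow> nat" where
  "f_max G f = Max (f ` verts G)"

text \<open>
  The bounds $|A| \le \hat f - 2$ and $|A| \le \hat f - 1$ are integer inequalities, written without
  subtraction because it truncates on \<open>nat\<close>; for $\hat f \le 1$ both families are empty.
\<close>

definition C0 :: "'v graph \<Rightarrow> ('v \<Rightarrow> nat) \<Rightarrow> nat \<Rightarrow> nat set set" where
  "C0 G f k = {A. A \<subseteq> {1..k} \<and> card A + 2 \<le> f_max G f}"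

definition C1 :: "'v graph \<Rightarrow> ('v \<Rightarrow> nat) \<Rightarrow> nat \<Rightarrow> nat set set" where
  "C1 G f k = {A. A \<subseteq> {1..k} \<and> 1 \<le> card A \<and> card A + 1 \<le> f_max G f}"

text \<open>
  The families \<open>TA\<close> and \<open>WA\<close> give $T^A$ and $W^A$; their values outside \<open>C0\<close> and \<open>C1\<close> are
  irrelevant.
\<close>

definition palette_system ::
  "'v graph \<Rightarrow> ('v \<Rightarrow> nat) \<Rightarrow> nat \<Rightarrow>
   'v set \<Rightarrow> 'v set \<Rightarrow> 'v set \<Rightarrow> (nat set \<Rightarrow> 'v set) \<Rightarrow> (nat set \<Rightarrow> 'v set) \<Rightarrow> bool" where
  "palette_system G f k S T W TA WA \<longleftrightarrow>
     S \<subseteq> verts G \<and> T \<subseteq> verts G \<and> W \<subseteq> verts G \<and>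
     S \<inter> T = {} \<and> S \<inter> W = {} \<and> T \<inter> W = {} \<and>
     disjoint_family_on TA (C0 G f k) \<and> T = (\<Union>A\<in>C0 G f k. TA A) \<and>
     disjoint_family_on WA (C1 G f k) \<and> W = (\<Union>A\<in>C1 G f k. WA A)"

definition X_palette ::
  "'v graph \<Rightarrow> ('v set \<Rightarrow> nat) \<Rightarrow> ('v \<Rightarrow> nat) \<Rightarrow> nat \<Rightarrow>
   'v set \<Rightarrow> (nat set \<Rightarrow> 'v set) \<Rightarrow> (nat set \<Rightarrow> 'v set) \<Rightarrow> ('v, nat) gadget_vertex set" where
  "X_palette G c f k S TA WA =
     (\<Union>u\<in>S. S_part_col G c u) \<union>
     (\<Union>A\<in>C0 G f k. \<Union>u\<in>TA A. T_part_col G c f u \<union> {Port u i | i. i \<in> A \<inter> colours_at G c u}) \<union>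
     (\<Union>A\<in>C1 G f k. \<Union>u\<in>WA A. {Port u i | i. i \<in> A \<inter> colours_at G c u})"

end

theory Submission
  imports Defs
begin

text \<open>
  Colour the edges of \<open>G\<close> with pairwise distinct colours. Then $G^c_f$ is isomorphic to $G_f$, so an $f$-factor exists by (P) as soon as
  $\mathrm{odd}(G_f - X) \le |X|$ for every $X$ that comes from a palette system. Such an $X$ contains
  all or nothing of each $T_u$. Let \<open>T\<close> consist of the vertices with $T_u \subseteq X$ and \<open>S\<close> of
  those outside \<open>T\<close> with $S_u \subseteq X$. Then $X \setminus X_{S,T}$ consists of ports, and each
  of them sees at most two components of the graph that remains: that of its partner and that of
  $T_u$, which is connected through a surviving port. Putting such a vertex back lowers the number of
  odd components by at most one, so the inequality for $X_{S,T}$ implies the one for $X$.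

  Conversely, an $f$-factor yields a perfect matching of $G_f$, and every odd component of
  $G_f - X$ is matched into $X$. This argument avoids palette systems, which are too few to express
  all pairs $(S,T)$ when $\hat f \le 1$.
\<close>

section \<open>Components\<close>

lemma adj_sym: "sym (adj H)"
  by (auto simp: sym_def adj_def insert_commute)

lemma adj_rtrancl_sym: "(x, y) \<in> (adj H)\<^sup>* \<Longrightarrow> (y, x) \<in> (adj H)\<^sup>*"
  using sym_rtrancl[OF adj_sym] by (metis symD)

lemma components_eq_Image: "components H = (\<lambda>x. (adj H)\<^sup>* `` {x}) ` verts H"
  by (auto simp: components_def Image_def)

text \<open>Reachability is an equivalence relation because \<open>adj H\<close> is symmetric, so
  any member of a component can serve as its representative.\<close>

lemma component_eq_Image:
  assumes "C \<in> components H" "x \<in> C"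
  shows "C = (adj H)\<^sup>* `` {x}"
proof -
  obtain y where y: "C = (adj H)\<^sup>* `` {y}" using assms(1) by (auto simp: components_eq_Image)
  hence "(y, x) \<in> (adj H)\<^sup>*" using assms(2) by auto
  with adj_rtrancl_sym[OF this] show ?thesis by (auto simp: y intro: rtrancl_trans)
qed

lemma adj_rtrancl_verts: "(x, y) \<in> (adj H)\<^sup>* \<Longrightarrow> x \<in> verts H \<Longrightarrow> y \<in> verts H"
  by (induction rule: rtrancl_induct) (auto simp: adj_def)

lemma component_subset_verts: "C \<in> components H \<Longrightarrow> C \<subseteq> verts H"
  by (auto simp: components_eq_Image adj_rtrancl_verts)

lemma component_nonempty: "C \<in> components H \<Longrightarrow> C \<noteq> {}"
  by (auto simp: components_eq_Image)

lemma finite_components: "finite (verts H) \<Longrightarrow> finite (components H)"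
  by (simp add: components_eq_Image)

lemma Image_rtrancl_subsetI:
  assumes "x \<in> C" "\<And>y z. y \<in> C \<Longrightarrow> (y, z) \<in> r \<Longrightarrow> z \<in> C"
  shows "r\<^sup>* `` {x} \<subseteq> C"
proof -
  have "z \<in> C" if "(x, z) \<in> r\<^sup>*" for z
    using that by (induction rule: rtrancl_induct) (auto intro: assms)
  thus ?thesis by auto
qed

section \<open>Deleting and restoring vertices\<close>

lemma verts_delete_verts: "verts (delete_verts H X) = verts H - X"
  by (simp add: delete_verts_def)

lemma adj_delete_verts:
  "adj (delete_verts H X) = {(a, b) \<in> adj H. a \<notin> X \<and> b \<notin> X}"
  by (auto simp: adj_def delete_verts_def)

text \<open>Restoring \<open>x\<close> fuses \<open>x\<close> with the components that contain a
  neighbour of it and leaves all others alone. By \<open>nbr\<close> at most two are fused. If two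
  odd ones are lost, the new component has odd + odd + 1 vertices and is odd itself, so the net loss
  is at most one.\<close>

lemma odd_components_restore_vertex:
  assumes fin: "finite (verts H)" and x: "x \<in> verts H" "x \<in> X"
    and nbr: "\<And>y. (x, y) \<in> adj H \<Longrightarrow> y \<notin> X \<Longrightarrow> y \<noteq> x \<Longrightarrow>
      (a, y) \<in> (adj (delete_verts H X))\<^sup>* \<or> (b, y) \<in> (adj (delete_verts H X))\<^sup>*"
  shows "odd_components (delete_verts H X)
    \<le> odd_components (delete_verts H (X - {x})) + 1"
proof -
  define K where "K = delete_verts H X"
  define L where "L = delete_verts H (X - {x})"
  define D where "D = (adj L)\<^sup>* `` {x}"
  define \<N> where "\<N> = {C \<in> components K. \<exists>y\<in>C. (x, y) \<in> adj H}"
  have finK: "finite (verts K)" "finite (verts L)"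
    using fin by (auto simp: K_def L_def verts_delete_verts)
  have xL: "x \<in> verts L" and xK: "x \<notin> verts K"
    using x by (auto simp: K_def L_def verts_delete_verts)
  have KL: "adj K \<subseteq> adj L" by (auto simp: K_def L_def adj_delete_verts)
  have LK: "(p, q) \<in> adj K" if "(p, q) \<in> adj L" "p \<noteq> x" "q \<noteq> x" for p q
    using that by (auto simp: K_def L_def adj_delete_verts)
  have Lsub: "(p, q) \<in> adj H" if "(p, q) \<in> adj L" for p q
    using that by (auto simp: L_def adj_delete_verts)
  have Lverts: "p \<in> verts K \<or> p = x" if "(p, q) \<in> adj L \<or> (q, p) \<in> adj L" for p q
    using that by (auto simp: L_def K_def adj_delete_verts verts_delete_verts adj_def)
  have Lx: "(x, q) \<in> adj L" if "(x, q) \<in> adj H" "q \<in> verts K" for q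
    using that x by (auto simp: L_def K_def adj_delete_verts verts_delete_verts)
  have closed: "q \<in> C" if "C \<in> components K" "p \<in> C" "(p, q) \<in> adj K" for C p q
    using that component_eq_Image[OF that(1,2)] by auto
  have conn: "(p, q) \<in> (adj L)\<^sup>*" if "C \<in> components K" "p \<in> C" "q \<in> C" for C p q
    using component_eq_Image[OF that(1,2)] that(3) rtrancl_mono[OF KL] by auto
  \<comment> \<open>Without a neighbour of \<open>x\<close>, a component of \<open>K\<close> is
    closed under the larger relation \<open>adj L\<close> as well.\<close>
  have untouched: "C \<in> components L" if C: "C \<in> components K" "C \<notin> \<N>" for C
  proof -
    obtain y where y: "y \<in> C" using component_nonempty[OF C(1)] by auto
    have yv: "y \<in> verts K" using y component_subset_verts[OF C(1)] by auto
    have "(adj L)\<^sup>* `` {y} \<subseteq> C"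
    proof (rule Image_rtrancl_subsetI[OF y])
      fix p q assume p: "p \<in> C" "(p, q) \<in> adj L"
      have "p \<noteq> x" using p(1) component_subset_verts[OF C(1)] xK by auto
      moreover have "q \<noteq> x"
      proof
        assume "q = x"
        hence "(x, p) \<in> adj H" using Lsub[OF p(2)] adj_sym[of H] by (meson symD)
        thus False using C p(1) by (auto simp: \<N>_def)
      qed
      ultimately show "q \<in> C" using LK[OF p(2)] closed[OF C(1) p(1)] by auto
    qed
    hence "C = (adj L)\<^sup>* `` {y}" using conn[OF C(1) y] by auto
    moreover have "y \<in> verts L" using yv by (auto simp: K_def L_def verts_delete_verts)
    ultimately show ?thesis by (auto simp: components_eq_Image)
  qed
  have D: "D = insert x (\<Union>\<N>)"
  proof
    show "D \<subseteq> insert x (\<Union>\<N>)" unfolding D_def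
    proof (rule Image_rtrancl_subsetI)
      fix p q assume p: "p \<in> insert x (\<Union>\<N>)" "(p, q) \<in> adj L"
      show "q \<in> insert x (\<Union>\<N>)"
      proof (cases "q = x \<or> p = x")
        case False
        then obtain C where "C \<in> \<N>" "p \<in> C" using p(1) by auto
        with False LK[OF p(2)] closed show ?thesis by (auto simp: \<N>_def)
      next
        case True
        show ?thesis
        proof (cases "q = x")
          case False
          hence "q \<in> verts K" using Lverts p(2) by blast
          hence "(adj K)\<^sup>* `` {q} \<in> components K" by (auto simp: components_eq_Image)
          moreover have "(x, q) \<in> adj H" using True False Lsub[OF p(2)] by auto
          ultimately have "(adj K)\<^sup>* `` {q} \<in> \<N>" by (auto simp: \<N>_def)
          thus ?thesis by auto
        qed auto
      qed
    qed auto
    show "insert x (\<Union>\<N>) \<subseteq> D"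
    proof -
      have "z \<in> D" if C: "C \<in> \<N>" "z \<in> C" for C z
      proof -
        obtain y where y: "y \<in> C" "(x, y) \<in> adj H" and CK: "C \<in> components K"
          using C(1) by (auto simp: \<N>_def)
        have "(x, y) \<in> adj L" using Lx y component_subset_verts[OF CK] by auto
        moreover have "(y, z) \<in> (adj L)\<^sup>*" using conn[OF CK y(1) C(2)] .
        ultimately show ?thesis by (auto simp: D_def)
      qed
      thus ?thesis by (auto simp: D_def)
    qed
  qed
  have DL: "D \<in> components L" using xL by (auto simp: D_def components_eq_Image)
  \<comment> \<open>Every component next to \<open>x\<close> contains \<open>a\<close> or
    \<open>b\<close>, hence is the class of one of them.\<close>
  have \<N>_sub: "\<N> \<subseteq> {(adj K)\<^sup>* `` {a}, (adj K)\<^sup>* `` {b}}"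
  proof
    fix C assume "C \<in> \<N>"
    then obtain y where y: "y \<in> C" "(x, y) \<in> adj H" and CK: "C \<in> components K"
      by (auto simp: \<N>_def)
    have "y \<notin> X" "y \<noteq> x"
      using y(1) component_subset_verts[OF CK] xK by (auto simp: K_def verts_delete_verts)
    hence "(a, y) \<in> (adj K)\<^sup>* \<or> (b, y) \<in> (adj K)\<^sup>*" using nbr[OF y(2)] by (simp add: K_def)
    hence "(y, a) \<in> (adj K)\<^sup>* \<or> (y, b) \<in> (adj K)\<^sup>*" using adj_rtrancl_sym by metis
    hence "a \<in> C \<or> b \<in> C" by (subst (1 2) component_eq_Image[OF CK y(1)]) simp
    thus "C \<in> {(adj K)\<^sup>* `` {a}, (adj K)\<^sup>* `` {b}}"
      using component_eq_Image[OF CK, of a] component_eq_Image[OF CK, of b] by blast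
  qed
  define oK where "oK = {C \<in> components K. odd (card C)}"
  define oL where "oL = {C \<in> components L. odd (card C)}"
  have fin_o: "finite oK" "finite oL" using finK[THEN finite_components] by (simp_all add: oK_def oL_def)
  have sub: "oK - \<N> \<subseteq> oL" using untouched by (auto simp: oK_def oL_def)
  have split: "card oK = card (oK - \<N>) + card (oK \<inter> \<N>)"
    using card_Int_Diff[OF fin_o(1), of \<N>] by linarith
  have "card oK \<le> card oL + 1"
  proof (cases "card (oK \<inter> \<N>) \<le> 1")
    case True
    thus ?thesis using split card_mono[OF fin_o(2) sub] by linarith
  next
    case False
    have "card (oK \<inter> \<N>) \<le> card {(adj K)\<^sup>* `` {a}, (adj K)\<^sup>* `` {b}}"
      using \<N>_sub by (intro card_mono) auto
    moreover have ab: "card {(adj K)\<^sup>* `` {a}, (adj K)\<^sup>* `` {b}} \<le> 2" by (simp add: card_insert_if)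
    ultimately have c2: "card (oK \<inter> \<N>) = 2" using False by linarith
    then obtain C1 C2 where C12: "oK \<inter> \<N> = {C1, C2}" "C1 \<noteq> C2" by (auto simp: card_2_iff)
    \<comment> \<open>Two of the at most two members of \<open>\<N>\<close> are odd, so
      \<open>\<N>\<close> has no further member and \<open>D\<close> is exactly \<open>x\<close>
      together with \<open>C1\<close> and \<open>C2\<close>.\<close>
    have "card \<N> \<le> 2"
      using card_mono[OF _ \<N>_sub] ab by simp
    moreover have "finite \<N>" using \<N>_sub finite_subset by blast
    ultimately have \<N>: "\<N> = {C1, C2}"
      using C12 c2 card_seteq[of \<N> "oK \<inter> \<N>"] by auto
    have mem: "C1 \<in> components K" "C2 \<in> components K" "odd (card C1)" "odd (card C2)"
      using C12 by (auto simp: oK_def)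
    have "C1 \<inter> C2 = {}"
      using component_eq_Image[OF mem(1)] component_eq_Image[OF mem(2)] C12(2) by (metis disjoint_iff)
    moreover have "x \<notin> C1" "x \<notin> C2" "finite C1" "finite C2"
      using component_subset_verts[OF mem(1)] component_subset_verts[OF mem(2)] xK finK(1)
      by (auto intro: finite_subset)
    ultimately have "card D = Suc (card C1 + card C2)"
      using D \<N> by (simp add: card_Un_disjoint)
    hence "D \<in> oL" using mem DL by (auto simp: oL_def)
    \<comment> \<open>Since \<open>D\<close> contains \<open>x\<close>, it is a new odd component
      and makes up for one of the two lost.\<close>
    moreover have "D \<notin> oK" using xK component_subset_verts[of D K] D by (auto simp: oK_def)
    ultimately have "insert D (oK - \<N>) \<subseteq> oL" "D \<notin> oK - \<N>" using sub by auto
    hence "Suc (card (oK - \<N>)) \<le> card oL"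
      using card_mono[OF fin_o(2), of "insert D (oK - \<N>)"] fin_o(1) by auto
    thus ?thesis using split c2 by linarith
  qed
  thus ?thesis by (simp add: odd_components_def oK_def oL_def K_def L_def)
qed

text \<open>An isomorphism carries components to components of the same size. As edges consist of
  vertices, injectivity on the vertices already recovers an edge from its image.\<close>

lemma odd_components_image:
  assumes inj: "inj_on \<phi> (verts H)" and sub: "\<forall>e\<in>edges H. e \<subseteq> verts H"
  shows "odd_components (\<phi> ` verts H, (`) \<phi> ` edges H) = odd_components H"
proof -
  let ?H = "(\<phi> ` verts H, (`) \<phi> ` edges H)"
  have adj_iff: "(\<phi> x, \<phi> y) \<in> adj ?H \<longleftrightarrow> (x, y) \<in> adj H" if "x \<in> verts H" "y \<in> verts H" for x y
  proof
    assume "(\<phi> x, \<phi> y) \<in> adj ?H"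
    then obtain e where e: "e \<in> edges H" "\<phi> ` {x, y} = \<phi> ` e" by (auto simp: adj_def)
    hence "{x, y} = e" using inj_on_image_eq_iff[OF inj, of "{x, y}" e] sub that by auto
    thus "(x, y) \<in> adj H" using that e by (auto simp: adj_def)
  next
    assume "(x, y) \<in> adj H"
    hence "\<phi> ` {x, y} \<in> (`) \<phi> ` edges H" by (intro imageI) (simp add: adj_def)
    thus "(\<phi> x, \<phi> y) \<in> adj ?H" using that by (simp add: adj_def)
  qed
  have adj_img: "q \<in> \<phi> ` verts H" if "(p, q) \<in> adj ?H" for p q
    using that by (auto simp: adj_def)
  have cls: "(adj ?H)\<^sup>* `` {\<phi> x} = \<phi> ` ((adj H)\<^sup>* `` {x})" if x: "x \<in> verts H" for x
  proof
    show "(adj ?H)\<^sup>* `` {\<phi> x} \<subseteq> \<phi> ` ((adj H)\<^sup>* `` {x})"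
    proof (rule Image_rtrancl_subsetI)
      fix p q assume p: "p \<in> \<phi> ` ((adj H)\<^sup>* `` {x})" "(p, q) \<in> adj ?H"
      obtain p' where p': "p = \<phi> p'" "(x, p') \<in> (adj H)\<^sup>*" using p(1) by auto
      obtain q' where q': "q = \<phi> q'" "q' \<in> verts H" using adj_img[OF p(2)] by auto
      have "(p', q') \<in> adj H" using adj_iff adj_rtrancl_verts[OF p'(2) x] q' p' p(2) by auto
      thus "q \<in> \<phi> ` ((adj H)\<^sup>* `` {x})" using p' q' by (auto intro: rtrancl.rtrancl_into_rtrancl)
    qed auto
    have "(\<phi> x, \<phi> y) \<in> (adj ?H)\<^sup>*" if "(x, y) \<in> (adj H)\<^sup>*" for y
      using that
    proof (induction rule: rtrancl_induct)
      case (step y z)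
      hence "(\<phi> y, \<phi> z) \<in> adj ?H" using adj_iff by (auto simp: adj_def)
      with step show ?case by (meson rtrancl.rtrancl_into_rtrancl)
    qed auto
    thus "\<phi> ` ((adj H)\<^sup>* `` {x}) \<subseteq> (adj ?H)\<^sup>* `` {\<phi> x}" by auto
  qed
  have "components ?H = (\<lambda>x. (adj ?H)\<^sup>* `` {\<phi> x}) ` verts H"
    by (simp add: components_eq_Image image_image)
  also have "\<dots> = (\<lambda>x. \<phi> ` ((adj H)\<^sup>* `` {x})) ` verts H" using cls by (rule image_cong[OF refl])
  finally have comps: "components ?H = (`) \<phi> ` components H"
    by (simp add: components_eq_Image image_image)
  have card_img: "card (\<phi> ` C) = card C" if "C \<in> components H" for C
    using card_image inj_on_subset[OF inj component_subset_verts[OF that]] by blast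
  have "{C \<in> components ?H. odd (card C)} = (`) \<phi> ` {C \<in> components H. odd (card C)}"
    using comps card_img by auto
  moreover have "inj_on ((`) \<phi>) {C \<in> components H. odd (card C)}"
    by (rule inj_onI) (simp add: inj_on_image_eq_iff[OF inj] component_subset_verts)
  ultimately show ?thesis unfolding odd_components_def by (simp add: card_image)
qed

section \<open>Perfect matchings\<close>

text \<open>A fixed-point-free involution partitions \<open>C\<close> into the pairs
  \<open>{x, m x}\<close>.\<close>

lemma even_card_involution:
  assumes "finite C" "\<And>x. x \<in> C \<Longrightarrow> m x \<in> C \<and> m x \<noteq> x \<and> m (m x) = x"
  shows "even (card C)"
proof -
  let ?P = "(\<lambda>x. {x, m x}) ` C"
  have "2 * card ?P = card (\<Union>?P)"
  proof (rule card_partition)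
    fix c assume "c \<in> ?P"
    thus "card c = 2" using assms(2) by (force simp: card_2_iff)
  next
    fix c1 c2 assume c: "c1 \<in> ?P" "c2 \<in> ?P" "c1 \<noteq> c2"
    then obtain x y where "c1 = {x, m x}" "c2 = {y, m y}" "x \<in> C" "y \<in> C" by auto
    moreover have "{z, m z} = {w, m w}" if "z \<in> {w, m w}" "w \<in> C" for z w
      using that assms(2)[OF that(2)] by auto
    ultimately show "c1 \<inter> c2 = {}" using c(3) by (metis disjoint_iff)
  qed (use assms in auto)
  moreover have "\<Union>?P = C" using assms(2) by auto
  ultimately show ?thesis by (metis dvd_triv_left)
qed

text \<open>The perfect matching is given by the involution \<open>m\<close> that swaps matched vertices.\<close>

lemma odd_components_le_if_perfect_matching:
  assumes fin: "finite (verts H)" "finite X"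
    and m: "\<And>x. x \<in> verts H \<Longrightarrow> (x, m x) \<in> adj H \<and> m x \<noteq> x \<and> m (m x) = x"
  shows "odd_components (delete_verts H X) \<le> card X"
proof -
  let ?K = "delete_verts H X"
  let ?O = "{C \<in> components ?K. odd (card C)}"
  have sub: "C \<subseteq> verts H - X" if "C \<in> components ?K" for C
    using component_subset_verts[OF that] by (simp add: verts_delete_verts)
  \<comment> \<open>If no vertex of \<open>C\<close> were matched into \<open>X\<close>, then
    \<open>m\<close> would be a fixed-point-free involution of \<open>C\<close>, against its odd
    size.\<close>
  have ex: "\<exists>x\<in>C. m x \<in> X" if C: "C \<in> ?O" for C
  proof (rule ccontr)
    assume none: "\<not> (\<exists>x\<in>C. m x \<in> X)"
    have "m x \<in> C \<and> m x \<noteq> x \<and> m (m x) = x" if x: "x \<in> C" for x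
    proof -
      have "x \<in> verts H" "x \<notin> X" using x C sub by auto
      moreover have "m x \<notin> X" using none x by auto
      ultimately have "(x, m x) \<in> adj ?K" using m by (simp add: adj_delete_verts)
      hence "m x \<in> C" using component_eq_Image[of C ?K x] C x by auto
      thus ?thesis using m[OF \<open>x \<in> verts H\<close>] by auto
    qed
    moreover have "finite C" using sub[of C] C fin(1) by (auto intro: finite_subset)
    ultimately have "even (card C)" by (rule even_card_involution[rotated])
    thus False using C by auto
  qed
  then obtain g where g: "\<And>C. C \<in> ?O \<Longrightarrow> g C \<in> C \<and> m (g C) \<in> X" by metis
  \<comment> \<open>An involution is injective, and the vertex \<open>g C\<close> determines the
    component containing it.\<close>
  have "inj_on (\<lambda>C. m (g C)) ?O"
  proof (rule inj_onI)
    fix C D assume C: "C \<in> ?O" and D: "D \<in> ?O" and eq: "m (g C) = m (g D)"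
    have "g C \<in> verts H" "g D \<in> verts H" using g C D sub by blast+
    hence "g C = g D" using eq m by metis
    thus "C = D" using g[OF C] g[OF D] C D component_eq_Image[of _ ?K "g C"] by auto
  qed
  moreover have "(\<lambda>C. m (g C)) ` ?O \<subseteq> X" using g by auto
  ultimately show ?thesis unfolding odd_components_def using card_inj_on_le fin(2) by blast
qed

section \<open>The gadget graph\<close>

lemma finite_edges: "finite_simple_graph G \<Longrightarrow> finite (edges G)"
  unfolding finite_simple_graph_def by (metis PowI finite_Pow_iff finite_subset subsetI)

lemma edgeD:
  assumes "finite_simple_graph G" "{u, v} \<in> edges G"
  shows "u \<in> verts G" "v \<in> verts G" "u \<noteq> v"
  using assms by (auto simp: finite_simple_graph_def)

lemma edge_at_obtain:
  assumes "finite_simple_graph G" "e \<in> edges G" "u \<in> e"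
  obtains v where "e = {u, v}"
proof -
  have "card e = 2" using assms by (auto simp: finite_simple_graph_def)
  thus ?thesis using that assms(3) by (auto simp: card_2_iff insert_commute)
qed

text \<open>Ports are indexed by neighbours while degrees count edges; \<open>v\<close> and
  \<open>{u, v}\<close> correspond to each other. The edge set \<open>B\<close> is left general so
  that the edges outside a factor can be counted.\<close>

lemma card_neighbours:
  assumes "finite_simple_graph G" "B \<subseteq> edges G"
  shows "card {v. {u, v} \<in> B} = card {e \<in> B. u \<in> e}"
proof -
  have "bij_betw (\<lambda>v. {u, v}) {v. {u, v} \<in> B} {e \<in> B. u \<in> e}"
  proof (rule bij_betw_imageI)
    show "inj_on (\<lambda>v. {u, v}) {v. {u, v} \<in> B}" by (auto simp: inj_on_def doubleton_eq_iff)
    have "e \<in> (\<lambda>v. {u, v}) ` {v. {u, v} \<in> B}" if "e \<in> B" "u \<in> e" for e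
      using that edge_at_obtain[OF assms(1), of e u] assms(2) by auto
    thus "(\<lambda>v. {u, v}) ` {v. {u, v} \<in> B} = {e \<in> B. u \<in> e}" by auto
  qed
  thus ?thesis by (rule bij_betw_same_card)
qed

lemma finite_neighbours:
  assumes "finite_simple_graph G"
  shows "finite {v. {u, v} \<in> edges G}"
  by (rule finite_subset[of _ "verts G"])
    (use assms edgeD in \<open>auto simp: finite_simple_graph_def\<close>)

section \<open>Vertices and adjacency of the gadget graph\<close>

lemma finite_S_part: "finite_simple_graph G \<Longrightarrow> finite (S_part G u)"
  using finite_neighbours[of G u] unfolding S_part_def by simp

lemma finite_T_part: "finite (T_part G f u)"
proof -
  have "T_part G f u = Slack u ` {1..degree G u - f u}" by (auto simp: T_part_def)
  thus ?thesis by simp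
qed

lemma finite_gadget_graph: "finite_simple_graph G \<Longrightarrow> finite (verts (gadget_graph G f))"
  by (auto simp: gadget_graph_def finite_S_part finite_T_part finite_simple_graph_def)

lemma Port_in_gadget_graph:
  assumes "finite_simple_graph G"
  shows "Port u v \<in> verts (gadget_graph G f) \<longleftrightarrow> {u, v} \<in> edges G"
  using edgeD[OF assms] by (auto simp: gadget_graph_def S_part_def T_part_def)

lemma Slack_in_gadget_graph:
  "Slack u i \<in> verts (gadget_graph G f) \<longleftrightarrow> u \<in> verts G \<and> 1 \<le> i \<and> i \<le> degree G u - f u"
  by (auto simp: gadget_graph_def S_part_def T_part_def)

lemma Port_Slack_adj:
  assumes "finite_simple_graph G" "{u, v} \<in> edges G" "Slack u i \<in> T_part G f u"
  shows "(Port u v, Slack u i) \<in> adj (gadget_graph G f)"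
  using assms edgeD[OF assms(1,2)]
  by (fastforce simp: adj_def gadget_graph_def S_part_def T_part_def)

lemma Port_Port_adj:
  assumes "finite_simple_graph G" "{u, v} \<in> edges G"
  shows "(Port u v, Port v u) \<in> adj (gadget_graph G f)"
proof -
  have "{v, u} \<in> edges G" using assms(2) by (simp add: insert_commute)
  hence "Port u v \<in> verts (gadget_graph G f)" "Port v u \<in> verts (gadget_graph G f)"
    using assms by (simp_all add: Port_in_gadget_graph)
  thus ?thesis using assms(2) by (auto simp: adj_def gadget_graph_def)
qed

text \<open>A port has a single neighbour outside its own gadget. This is what limits a restored
  port to two components.\<close>

lemma Port_adjD:
  assumes "(Port u v, y) \<in> adj (gadget_graph G f)"
  shows "y = Port v u \<or> y \<in> T_part G f u"
  using assms by (auto simp: adj_def gadget_graph_def S_part_def T_part_def doubleton_eq_iff)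

lemma gadget_graph_edge_subset:
  assumes "finite_simple_graph G" "e \<in> edges (gadget_graph G f)"
  shows "e \<subseteq> verts (gadget_graph G f)"
proof -
  from assms(2) consider (inner) s t u where "e = {s, t}" "u \<in> verts G" "s \<in> S_part G u" "t \<in> T_part G f u"
    | (outer) u v where "e = {Port u v, Port v u}" "{u, v} \<in> edges G"
    by (auto simp: gadget_graph_def)
  thus ?thesis
  proof cases
    case inner
    thus ?thesis by (auto simp: gadget_graph_def)
  next
    case outer
    thus ?thesis using assms(1) by (simp add: Port_in_gadget_graph insert_commute)
  qed
qed

text \<open>An edge \<open>uv\<close> of \<open>F\<close> matches its two ports with each other. The
  remaining ports of \<open>u\<close> number \<open>degree G u - f u\<close>, as many as $T_u$ has
  vertices, and are matched with them. The resulting matching is perfect and bounds the odd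
  components for any finite \<open>X\<close>.\<close>

lemma odd_components_gadget_le_if_f_factor:
  assumes G: "finite_simple_graph G" and F: "f_factor G f F" and X: "finite X"
  shows "odd_components (delete_verts (gadget_graph G f) X) \<le> card X"
proof -
  \<comment> \<open>The labels of the ports of \<open>u\<close> that are to be matched into
    $T_u$.\<close>
  define N where "N = (\<lambda>u. {v. {u, v} \<in> edges G - edges F})"
  have FG: "edges F \<subseteq> edges G" using F by (auto simp: f_factor_def spanning_subgraph_def)
  have ex: "\<exists>b. bij_betw b (N u) {1..degree G u - f u}" if u: "u \<in> verts G" for u
  proof -
    have finE: "finite {e \<in> edges G. u \<in> e}" using finite_edges[OF G] by simp
    have eq: "{e \<in> edges G - edges F. u \<in> e} = {e \<in> edges G. u \<in> e} - {e \<in> edges F. u \<in> e}"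
      by auto
    have "card (N u) = card {e \<in> edges G - edges F. u \<in> e}"
      unfolding N_def by (rule card_neighbours[OF G]) auto
    also have "\<dots> = degree G u - degree F u"
      unfolding eq degree_def using FG by (intro card_Diff_subset finite_subset[OF _ finE]) auto
    also have "\<dots> = degree G u - f u" using F u by (auto simp: f_factor_def)
    finally have "card (N u) = card {1..degree G u - f u}" by simp
    moreover have "finite (N u)"
      using finite_neighbours[OF G, of u] by (rule finite_subset[rotated]) (auto simp: N_def)
    ultimately show ?thesis by (intro finite_same_card_bij) auto
  qed
  then obtain b where b: "\<And>u. u \<in> verts G \<Longrightarrow> bij_betw (b u) (N u) {1..degree G u - f u}"
    by metis
  \<comment> \<open>Slack vertices go back along the inverse of \<open>b u\<close>, which makes
    \<open>m\<close> an involution on the vertices of the gadget graph.\<close>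
  define m where "m = (\<lambda>x. case x of
      Port u v \<Rightarrow> if {u, v} \<in> edges F then Port v u else Slack u (b u v)
    | Slack u i \<Rightarrow> Port u (inv_into (N u) (b u) i))"
  show ?thesis
  proof (rule odd_components_le_if_perfect_matching[OF finite_gadget_graph[OF G] X, where m = m])
    fix x assume x: "x \<in> verts (gadget_graph G f)"
    show "(x, m x) \<in> adj (gadget_graph G f) \<and> m x \<noteq> x \<and> m (m x) = x"
    proof (cases x)
      case (Port u v)
      hence e: "{u, v} \<in> edges G" using x Port_in_gadget_graph[OF G] by simp
      note uv = edgeD[OF G e]
      show ?thesis
      proof (cases "{u, v} \<in> edges F")
        case True
        moreover have "{v, u} \<in> edges F" using True by (simp add: insert_commute)
        ultimately show ?thesis using Port Port_Port_adj[OF G e] uv by (simp add: m_def)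
      next
        case False
        hence v: "v \<in> N u" using e by (simp add: N_def)
        hence "b u v \<in> {1..degree G u - f u}" using b[OF uv(1)] by (auto simp: bij_betw_def)
        hence "Slack u (b u v) \<in> T_part G f u" by (auto simp: T_part_def)
        moreover have "inv_into (N u) (b u) (b u v) = v"
          using b[OF uv(1)] v by (simp add: bij_betw_inv_into_left)
        ultimately show ?thesis using False Port Port_Slack_adj[OF G e] by (simp add: m_def)
      qed
    next
      case (Slack u i)
      hence i: "u \<in> verts G" "i \<in> {1..degree G u - f u}" using x by (auto simp: Slack_in_gadget_graph)
      define v where "v = inv_into (N u) (b u) i"
      have v: "v \<in> N u" "b u v = i"
        using b[OF i(1)] i(2) unfolding v_def
        by (auto simp: bij_betw_def inv_into_into bij_betw_inv_into_right f_inv_into_f)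
      have "Slack u i \<in> T_part G f u" using i by (auto simp: T_part_def)
      hence "(Port u v, Slack u i) \<in> adj (gadget_graph G f)"
        using Port_Slack_adj[OF G] v by (auto simp: N_def)
      hence "(Slack u i, Port u v) \<in> adj (gadget_graph G f)" using adj_sym by (meson symD)
      moreover have "m x = Port u v" by (simp add: m_def Slack v_def)
      moreover have "m (Port u v) = Slack u i" using v by (simp add: m_def N_def)
      ultimately show ?thesis using Slack by simp
    qed
  qed
qed

text \<open>
  If $T_u = \emptyset$ then \<open>u\<close> belongs to \<open>T\<close>, so a port of a vertex outside \<open>T\<close> can only be
  put back while some other port of that vertex joins $T_u$ into one component.
\<close>

lemma odd_components_gadget_le_if_T_part_saturated:
  assumes G: "finite_simple_graph G"
    and ST: "\<forall>S T. S \<subseteq> verts G \<and> T \<subseteq> verts G \<and> S \<inter> T = {} \<longrightarrow>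
        odd_components (delete_verts (gadget_graph G f) (X_ST G f S T)) \<le> card (X_ST G f S T)"
    and X: "X \<subseteq> verts (gadget_graph G f)"
    and sat: "\<forall>u\<in>verts G. T_part G f u \<subseteq> X \<or> T_part G f u \<inter> X = {}"
  shows "odd_components (delete_verts (gadget_graph G f) X) \<le> card X"
proof -
  let ?H = "gadget_graph G f"
  define T where "T = {u \<in> verts G. T_part G f u \<subseteq> X}"
  \<comment> \<open>A vertex whose two parts both lie in \<open>X\<close> is assigned to
    \<open>T\<close>, which keeps \<open>S\<close> and \<open>T\<close> disjoint.\<close>
  define S where "S = {u \<in> verts G. S_part G u \<subseteq> X} - T"
  define Z where "Z = X_ST G f S T"
  have ZX: "Z \<subseteq> X" by (auto simp: Z_def X_ST_def S_def T_def)
  have Z: "odd_components (delete_verts ?H Z) \<le> card Z"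
  proof -
    have "S \<subseteq> verts G" "T \<subseteq> verts G" "S \<inter> T = {}" by (auto simp: S_def T_def)
    thus ?thesis using ST by (simp add: Z_def)
  qed
  have finX: "finite X" using X finite_gadget_graph[OF G] by (rule finite_subset)
  \<comment> \<open>The vertices of \<open>X - Z\<close> are deleted one at a time after
    \<open>Z\<close>. Each deletion raises the right side by one and the left side by at most
    one.\<close>
  have "odd_components (delete_verts ?H (Z \<union> Y)) \<le> card (Z \<union> Y)"
    if "finite Y" "Y \<subseteq> X - Z" for Y
    using that
  proof (induction Y rule: finite_induct)
    case empty
    show ?case using Z by simp
  next
    case (insert x Y)
    let ?X = "insert x (Z \<union> Y)"
    have xX: "x \<in> X" "x \<notin> Z" "?X \<subseteq> X" using insert.prems ZX by auto
    have xH: "x \<in> verts ?H" using xX X by auto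
    \<comment> \<open>A slack vertex in \<open>X\<close> forces its whole part into \<open>X\<close>
      by saturation, so it already lies in \<open>Z\<close>. Only ports remain.\<close>
    obtain u v where x: "x = Port u v"
    proof (cases x)
      case (Slack u i)
      hence "u \<in> verts G" "x \<in> T_part G f u"
        using xH by (auto simp: Slack_in_gadget_graph T_part_def)
      hence "u \<in> T" using sat xX by (auto simp: T_def)
      hence "x \<in> Z" using \<open>x \<in> T_part G f u\<close> by (auto simp: Z_def X_ST_def)
      thus ?thesis using xX by simp
    qed
    have e: "{u, v} \<in> edges G" using xH x Port_in_gadget_graph[OF G] by simp
    note u = edgeD(1)[OF G e]
    have xS: "x \<in> S_part G u" using e x by (auto simp: S_part_def)
    hence uS: "u \<notin> S" using xX by (auto simp: Z_def X_ST_def)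
    \<comment> \<open>The witness \<open>b\<close> represents the component of $T_u$. For
      \<open>u\<close> in \<open>T\<close> nothing of $T_u$ survives and any \<open>b\<close> will
      do; otherwise \<open>b\<close> is a port of \<open>u\<close> outside \<open>X\<close>,
      adjacent to all of $T_u$ and outside every intermediate set.\<close>
    obtain b where b: "\<And>y. y \<in> T_part G f u \<Longrightarrow> y \<notin> ?X \<Longrightarrow> (b, y) \<in> (adj (delete_verts ?H ?X))\<^sup>*"
    proof (cases "u \<in> T")
      case True
      hence "T_part G f u \<subseteq> ?X" by (auto simp: Z_def X_ST_def)
      thus ?thesis using that by blast
    next
      case False
      hence "\<not> S_part G u \<subseteq> X" using uS u by (auto simp: S_def)
      then obtain w where w: "{u, w} \<in> edges G" "Port u w \<notin> X" by (auto simp: S_part_def)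
      have "(Port u w, y) \<in> (adj (delete_verts ?H ?X))\<^sup>*" if "y \<in> T_part G f u" "y \<notin> ?X" for y
      proof -
        have "(Port u w, y) \<in> adj ?H"
          using Port_Slack_adj[OF G w(1)] that(1) by (auto simp: T_part_def)
        moreover have "Port u w \<notin> ?X" using w xX by blast
        ultimately show ?thesis using that(2) by (auto simp: adj_delete_verts)
      qed
      thus ?thesis using that by blast
    qed
    \<comment> \<open>The partner port \<open>Port v u\<close> reaches itself by reflexivity; every
      other neighbour of \<open>x\<close> lies in $T_u$ and is reached from \<open>b\<close> if it
      survives.\<close>
    have "odd_components (delete_verts ?H ?X) \<le> odd_components (delete_verts ?H (?X - {x})) + 1"
      using Port_adjD[of u v _ G f] b x
      by (intro odd_components_restore_vertex[OF finite_gadget_graph[OF G] xH, where a = "Port v u" and b = b])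
        auto
    moreover have "?X - {x} = Z \<union> Y" using xX insert.hyps by auto
    moreover have "card ?X = Suc (card (Z \<union> Y))"
      using xX insert.hyps finite_subset[OF ZX finX] by simp
    ultimately show ?case using insert by simp
  qed
  from this[of "X - Z"] show ?thesis using finX ZX by (simp add: Un_absorb1)
qed

section \<open>Rainbow colourings\<close>

text \<open>For a colouring with distinct colours this is the isomorphism from $G_f$ to $G^c_f$: the
  edge behind a port is named by its colour instead of its other end.\<close>

fun colour_port :: "('v set \<Rightarrow> nat) \<Rightarrow> ('v, 'v) gadget_vertex \<Rightarrow> ('v, nat) gadget_vertex" where
  "colour_port c (Port u v) = Port u (c {u, v})"
| "colour_port c (Slack u i) = Slack u i"

context
  fixes G :: "'v graph" and c :: "'v set \<Rightarrow> nat"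
  assumes G: "finite_simple_graph G" and c: "inj_on c (edges G)"
begin

lemma rainbow_colour_degree: "colour_degree G c u = degree G u"
  unfolding colour_degree_def colours_at_def degree_def
  by (rule card_image) (use c in \<open>auto simp: inj_on_def\<close>)

text \<open>The colour of a port determines the edge, and the edge together with \<open>u\<close>
  determines its other end.\<close>

lemma inj_on_colour_port: "inj_on (colour_port c) (verts (gadget_graph G f))"
proof (rule inj_onI)
  fix x y assume "x \<in> verts (gadget_graph G f)" "y \<in> verts (gadget_graph G f)"
    "colour_port c x = colour_port c y"
  thus "x = y" using c Port_in_gadget_graph[OF G]
    by (cases x; cases y) (auto dest!: inj_onD simp: doubleton_eq_iff)
qed

lemma S_part_col_rainbow: "S_part_col G c u = colour_port c ` S_part G u"
proof -
  have "colours_at G c u = (\<lambda>v. c {u, v}) ` {v. {u, v} \<in> edges G}"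
  proof -
    have "{e \<in> edges G. u \<in> e} = (\<lambda>v. {u, v}) ` {v. {u, v} \<in> edges G}"
      by (auto elim: edge_at_obtain[OF G])
    thus ?thesis by (simp add: colours_at_def image_image)
  qed
  moreover have "S_part_col G c u = Port u ` colours_at G c u" by (auto simp: S_part_col_def)
  moreover have "S_part G u = Port u ` {v. {u, v} \<in> edges G}" by (auto simp: S_part_def)
  ultimately show ?thesis by (simp add: image_image)
qed

lemma T_part_col_rainbow: "T_part_col G c f u = colour_port c ` T_part G f u"
  by (force simp: T_part_col_def T_part_def rainbow_colour_degree)

lemma gadget_graph_col_rainbow:
  "gadget_graph_col G c f =
    (colour_port c ` verts (gadget_graph G f), (`) (colour_port c) ` edges (gadget_graph G f))"
proof (rule prod_eqI)
  show "verts (gadget_graph_col G c f) = verts (colour_port c ` verts (gadget_graph G f),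
      (`) (colour_port c) ` edges (gadget_graph G f))"
    by (simp add: gadget_graph_col_def gadget_graph_def S_part_col_rainbow T_part_col_rainbow
        image_UN image_Un)
  have "{{s, t} | s t u. u \<in> verts G \<and> s \<in> S_part_col G c u \<and> t \<in> T_part_col G c f u} =
      (`) (colour_port c) ` {{s, t} | s t u. u \<in> verts G \<and> s \<in> S_part G u \<and> t \<in> T_part G f u}"
    (is "?L = _ ` ?R")
  proof
    show "?L \<subseteq> (`) (colour_port c) ` ?R"
    proof
      fix e assume "e \<in> ?L"
      then obtain s t u where "e = colour_port c ` {s, t}" "u \<in> verts G" "s \<in> S_part G u" "t \<in> T_part G f u"
        unfolding S_part_col_rainbow T_part_col_rainbow by auto
      thus "e \<in> (`) (colour_port c) ` ?R" by blast
    qed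
    show "(`) (colour_port c) ` ?R \<subseteq> ?L"
      unfolding S_part_col_rainbow T_part_col_rainbow by auto
  qed
  moreover have "{{Port u j, Port v j} | u v j. {u, v} \<in> edges G \<and> c {u, v} = j} =
      (`) (colour_port c) ` {{Port u v, Port v u} | u v. {u, v} \<in> edges G}" (is "?L = _ ` ?R")
  proof -
    \<comment> \<open>Partner ports receive the same colour because \<open>{u, v}\<close> and
      \<open>{v, u}\<close> are the same edge.\<close>
    have im: "colour_port c ` {Port u v, Port v u} = {Port u (c {u, v}), Port v (c {u, v})}" for u v
      by (simp add: insert_commute)
    show ?thesis
    proof
      show "?L \<subseteq> (`) (colour_port c) ` ?R"
      proof
        fix e assume "e \<in> ?L"
        then obtain u v where "e = colour_port c ` {Port u v, Port v u}" "{u, v} \<in> edges G"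
          unfolding im by blast
        thus "e \<in> (`) (colour_port c) ` ?R" by blast
      qed
      show "(`) (colour_port c) ` ?R \<subseteq> ?L"
      proof
        fix e assume "e \<in> (`) (colour_port c) ` ?R"
        then obtain u v where "e = colour_port c ` {Port u v, Port v u}" "{u, v} \<in> edges G"
          by blast
        thus "e \<in> ?L" unfolding im by blast
      qed
    qed
  qed
  ultimately show "edges (gadget_graph_col G c f) = edges (colour_port c ` verts (gadget_graph G f),
      (`) (colour_port c) ` edges (gadget_graph G f))"
    by (simp add: gadget_graph_col_def gadget_graph_def image_Un)
qed

text \<open>\<open>X\<close> and all edges lie where \<open>colour_port c\<close> is injective, so
  deletion commutes with taking images and the isomorphism restricts to what is left.\<close>

lemma odd_components_gadget_graph_col_rainbow:
  assumes X: "X \<subseteq> verts (gadget_graph G f)"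
  shows "odd_components (delete_verts (gadget_graph_col G c f) (colour_port c ` X)) =
    odd_components (delete_verts (gadget_graph G f) X)"
proof -
  let ?H = "gadget_graph G f" and ?\<phi> = "colour_port c"
  let ?K = "delete_verts ?H X"
  have inj: "inj_on ?\<phi> (verts ?H)" by (rule inj_on_colour_port)
  have sub: "e \<subseteq> verts ?H" if "e \<in> edges ?H" for e
    using gadget_graph_edge_subset[OF G that] .
  have "?\<phi> ` e \<inter> ?\<phi> ` X = {} \<longleftrightarrow> e \<inter> X = {}" if "e \<in> edges ?H" for e
    using inj_on_image_Int[OF inj sub[OF that] X] by (metis image_is_empty)
  hence "delete_verts (gadget_graph_col G c f) (?\<phi> ` X) = (?\<phi> ` verts ?K, (`) ?\<phi> ` edges ?K)"
    using inj_on_image_set_diff[OF inj _ X, of "verts ?H"]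
    by (auto simp: gadget_graph_col_rainbow delete_verts_def)
  moreover have "odd_components (?\<phi> ` verts ?K, (`) ?\<phi> ` edges ?K) = odd_components ?K"
  proof (rule odd_components_image)
    show "inj_on ?\<phi> (verts ?K)" using inj by (rule inj_on_subset) (auto simp: delete_verts_def)
    show "\<forall>e\<in>edges ?K. e \<subseteq> verts ?K" using sub by (auto simp: delete_verts_def)
  qed
  ultimately show ?thesis by simp
qed

end

text \<open>Slack vertices enter \<open>X_palette\<close> only through the full part of a vertex in
  some \<open>TA A\<close>; the other contributions are ports.\<close>

lemma X_palette_T_part_saturated:
  assumes "palette_system G f k S T W TA WA"
  shows "T_part_col G c f u \<subseteq> X_palette G c f k S TA WA \<or>
    T_part_col G c f u \<inter> X_palette G c f k S TA WA = {}"
proof (cases "\<exists>A\<in>C0 G f k. u \<in> TA A")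
  case True
  thus ?thesis unfolding X_palette_def by blast
next
  case False
  thus ?thesis by (auto simp: X_palette_def T_part_col_def S_part_col_def)
qed

lemma X_palette_subset:
  assumes "palette_system G f k S T W TA WA"
  shows "X_palette G c f k S TA WA \<subseteq> verts (gadget_graph_col G c f)"
proof -
  have "S \<subseteq> verts G" "(\<Union>A\<in>C0 G f k. TA A) \<subseteq> verts G" "(\<Union>A\<in>C1 G f k. WA A) \<subseteq> verts G"
    using assms unfolding palette_system_def by (elim conjE, simp only:)+
  thus ?thesis unfolding X_palette_def gadget_graph_col_def S_part_col_def by fastforce
qed

text \<open>(P) is assumed at the vertex type of the conclusion, as it is applied to
  \<open>G\<close> itself with a new colouring.\<close>

theorem theorem2p2:
  assumes P: "\<forall>(G :: 'v graph) k c f.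
      finite_simple_graph G \<and> edge_colouring G k c \<and> (\<forall>v\<in>verts G. f v \<le> colour_degree G c v) \<longrightarrow>
      ((\<exists>F. f_factor G f F \<and> properly_coloured F c) \<longleftrightarrow>
       (\<forall>S T W TA WA. palette_system G f k S T W TA WA \<longrightarrow>
          odd_components (delete_verts (gadget_graph_col G c f) (X_palette G c f k S TA WA))
            \<le> card (X_palette G c f k S TA WA)))"
  shows "\<forall>(G :: 'v graph) f.
      finite_simple_graph G \<and> (\<forall>v\<in>verts G. f v \<le> degree G v) \<longrightarrow>
      ((\<exists>F. f_factor G f F) \<longleftrightarrow>
       (\<forall>S T. S \<subseteq> verts G \<and> T \<subseteq> verts G \<and> S \<inter> T = {} \<longrightarrow>
          odd_components (delete_verts (gadget_graph G f) (X_ST G f S T)) \<le> card (X_ST G f S T)))"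
proof (intro allI impI iffI, goal_cases)
  case (1 G f S T)
  then obtain F where "f_factor G f F" by blast
  moreover have "finite (X_ST G f S T)"
  proof -
    have "finite S" "finite T"
      using 1 by (auto simp: finite_simple_graph_def intro: finite_subset)
    thus ?thesis using 1 by (simp add: X_ST_def finite_S_part finite_T_part)
  qed
  ultimately show ?case using 1 odd_components_gadget_le_if_f_factor by blast
next
  case (2 G f)
  hence G: "finite_simple_graph G" by simp
  \<comment> \<open>With one colour per edge, a bijection onto \<open>{1..?k}\<close> is a colouring
    in which all colours differ.\<close>
  let ?k = "card (edges G)"
  obtain c where c: "bij_betw c (edges G) {1..?k}"
    using finite_same_card_bij[OF finite_edges[OF G], of "{1..?k}"] by auto
  hence inj: "inj_on c (edges G)" by (simp add: bij_betw_def)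
  have col: "edge_colouring G ?k c" using c by (auto simp: edge_colouring_def bij_betw_def)
  have "odd_components (delete_verts (gadget_graph_col G c f) (X_palette G c f ?k S TA WA))
      \<le> card (X_palette G c f ?k S TA WA)" if pal: "palette_system G f ?k S T W TA WA" for S T W TA WA
  proof -
    let ?H = "gadget_graph G f" and ?Y = "X_palette G c f ?k S TA WA"
    \<comment> \<open>The palette set is pulled back to $G_f$ along the isomorphism, where the
      hypothesis on pairs \<open>S\<close>, \<open>T\<close> applies.\<close>
    define X where "X = {x \<in> verts ?H. colour_port c x \<in> ?Y}"
    have X: "X \<subseteq> verts ?H" by (auto simp: X_def)
    have Y: "?Y = colour_port c ` X"
      using X_palette_subset[OF pal, of c]
      by (auto simp: X_def gadget_graph_col_rainbow[OF G inj])
    have sat: "T_part G f u \<subseteq> X \<or> T_part G f u \<inter> X = {}" if "u \<in> verts G" for u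
    proof -
      have "T_part G f u \<subseteq> verts ?H" using that by (auto simp: gadget_graph_def)
      thus ?thesis using X_palette_T_part_saturated[OF pal, of c u]
        unfolding T_part_col_rainbow[OF G inj] X_def by auto
    qed
    have "card ?Y = card X"
      unfolding Y using inj_on_subset[OF inj_on_colour_port[OF G inj] X] by (rule card_image)
    moreover have "odd_components (delete_verts ?H X) \<le> card X"
      using odd_components_gadget_le_if_T_part_saturated[OF G _ X] 2(2) sat by blast
    ultimately show ?thesis
      using odd_components_gadget_graph_col_rainbow[OF G inj X] Y by simp
  qed
  moreover have "\<forall>v\<in>verts G. f v \<le> colour_degree G c v"
    using 2 by (simp add: rainbow_colour_degree[OF G inj])
  \<comment> \<open>(P) yields a properly coloured factor, which is in particular an
    $f$-factor.\<close>
  ultimately show ?case using P G col by blast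
qed

end
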